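(* Let $0\le c\le 1$ and $K$ a positive integer. Let $A:[0,1)^2\to[0,1]$ be a function with $\int_0^1\int_0^1 A(x,y)\,\mathrm{d}x\,\mathrm{d}y=c$ and $A(x,y)=A(y,x)$ for all $0\le x,y<1$, and suppose there are numbers $0=q_0<q_1<\dots<q_K=1$ such that $A$ is constant on each rectangle $[q_{i-1},q_i)\times[q_{j-1},q_j)$, $1\le i,j\le K$. For $x\in[0,1)$ let $\ell(x)=\int_0^1 A(x,y)\,\mathrm{d}y$ and let $$S(A)=\int_0^1\int_0^1 \ell(x)\ell(y)\min(\ell(x),\ell(y))\,\mathrm{d}x\,\mathrm{d}y.$$ Let $A_1(c):[0,1)^2\to[0,1]$ be defined by $A_1(c)(x,y)=1$ if $\min(x,y)<1-\sqrt{1-c}$ and $0$ otherwise, and $A_2(c):[0,1)^2\to[0,1]$ by $A_2(c)(x,y)=1$ if $\max(x,y)<\sqrt{c}$ and $0$ otherwise. Then $$S(A)\le \max\big(S(A_1(c)),S(A_2(c))\big)=\max\Big((1-\sqrt{1-c})^2\big((c+1)\sqrt{1-c}+c\big),\ c^{5/2}\Big).$$ *)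

theory Defs
  imports "HOL-Analysis.Analysis"
begin

text \<open>
  A kernel on \<open>[0,1)\<^sup>2\<close> is represented by a total curried function; every notion below
  only looks at its values on \<open>{0..<1}\<close>.
\<close>

definition deg :: "(real \<Rightarrow> real \<Rightarrow> real) \<Rightarrow> real \<Rightarrow> real" where
  "deg A x = (LBINT y:{0..<1}. A x y)"

definition S :: "(real \<Rightarrow> real \<Rightarrow> real) \<Rightarrow> real" where
  "S A = (LBINT y:{0..<1}. LBINT x:{0..<1}. deg A x * deg A y * min (deg A x) (deg A y))"

definition A1 :: "real \<Rightarrow> real \<Rightarrow> real \<Rightarrow> real" where
  "A1 c x y = (if min x y < 1 - sqrt (1 - c) then 1 else 0)"

definition A2 :: "real \<Rightarrow> real \<Rightarrow> real \<Rightarrow> real" where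
  "A2 c x y = (if max x y < sqrt c then 1 else 0)"

end

theory Submission
  imports Defs
begin

text \<open>
  Permuting the steps, let the degree function \<open>l\<close> be nonincreasing and put
  \<open>L t = \<integral>\<^sub>0\<^sup>t l\<close>; then \<open>S = 2 \<integral> L l\<^sup>2\<close>. Cut at the point \<open>a\<close> where \<open>l\<close> crosses the diagonal and
  write \<open>L t = a t + V t\<close> on \<open>[0,a]\<close>, \<open>x = V a\<close>, \<open>b = \<integral>\<^sub>a\<^sup>1 l\<close>, \<open>q = \<integral>\<^sub>0\<^sup>a V\<close>, \<open>G = \<integral>\<^sub>a\<^sup>1 l\<^sup>2\<close>.
  On \<open>[0,a]\<close> concavity of \<open>V\<close> bounds \<open>L l\<^sup>2\<close> pointwise by functions that integrate exactly up to a
  multiple of \<open>q\<close>; on \<open>[a,1]\<close> a Chebyshev argument gives \<open>2 \<integral> L l\<^sup>2 \<le> (L a + L 1) G\<close>. The kernel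
  enters only through the continuous Erdos--Gallai condition \<open>L t \<le> \<integral>\<^sub>0\<^sup>1 min t (l y) dy\<close>: at
  \<open>t = a\<close> it says \<open>x \<le> b\<close>, and integrated over \<open>[0,a]\<close> it says \<open>q + G / 2 \<le> a b\<close>. What remains
  is a polynomial inequality, linear in \<open>q\<close> and \<open>G\<close>; according to the signs of their coefficients
  the bound is compared with the value of the clique or with that of the star.
\<close>

section \<open>The values of the extremal kernels\<close>

definition star_value :: "real \<Rightarrow> real" where
  "star_value c = (1 - sqrt (1 - c))\<^sup>2 * ((c + 1) * sqrt (1 - c) + c)"

definition clique_value :: "real \<Rightarrow> real" where
  "clique_value c = sqrt c ^ 5"

definition extremal_value :: "real \<Rightarrow> real" where
  "extremal_value c = max (star_value c) (clique_value c)"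

lemma sqrt_one_minus_star_density:
  fixes s :: real
  assumes "s \<le> 1"
  shows "sqrt (1 - s * (2 - s)) = 1 - s"
proof -
  have "1 - s * (2 - s) = (1 - s)\<^sup>2"
    by (simp add: power2_eq_square algebra_simps)
  then show ?thesis
    using assms by simp
qed

lemma star_density_cases:
  fixes c :: real
  assumes "0 \<le> c" "c \<le> 1"
  obtains s where "0 \<le> s" "s \<le> 1" "c = s * (2 - s)"
proof
  let ?s = "1 - sqrt (1 - c)"
  show "0 \<le> ?s" "?s \<le> 1"
    using assms by auto
  have "?s * (2 - ?s) = 1 - (sqrt (1 - c))\<^sup>2"
    by (simp add: power2_eq_square algebra_simps)
  then show "c = ?s * (2 - ?s)"
    using assms by simp
qed

lemma star_value_star_density:
  assumes "s \<le> 1"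
  shows "star_value (s * (2 - s)) = s\<^sup>2 * (1 + 3 * s - 4 * s\<^sup>2 + s ^ 3)"
  unfolding star_value_def sqrt_one_minus_star_density[OF assms]
  by (simp add: eval_nat_numeral algebra_simps)

lemma quarter_square_le_star_value:
  assumes "0 \<le> c" "c \<le> 1"
  shows "c\<^sup>2 / 4 \<le> star_value c"
proof -
  obtain s where s: "0 \<le> s" "s \<le> 1" and c: "c = s * (2 - s)"
    using star_density_cases[OF assms] .
  have "star_value c - c\<^sup>2 / 4 = s ^ 3 * ((1 - s) * (4 - s) + 3 / 4 * s)"
    unfolding c star_value_star_density[OF s(2)] by (simp add: field_simps eval_nat_numeral)
  also have "\<dots> \<ge> 0"
    using s by simp
  finally show ?thesis
    by simp
qed

lemma clique_value_eq_powr: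
  assumes "0 \<le> c"
  shows "clique_value c = c powr (5 / 2)"
  using assms by (simp add: clique_value_def powr_powr flip: powr_half_sqrt powr_numeral)

lemma clique_value_scale:
  assumes "0 \<le> a"
  shows "clique_value (a\<^sup>2 * v) = a ^ 5 * clique_value v"
  using assms by (simp add: clique_value_def real_sqrt_mult power_mult_distrib)

lemma le_clique_valueI:
  assumes "0 \<le> v" "n\<^sup>2 \<le> v ^ 5"
  shows "n \<le> clique_value v"
  using real_le_rsqrt[OF assms(2)] by (simp add: clique_value_def real_sqrt_power)

text \<open>
  The value of \<open>S\<close> for a star together with a clique: the threshold kernel with degrees \<open>1\<close> on \<open>[0,h)\<close>,
  \<open>a\<close> on \<open>[h,a)\<close> and \<open>h\<close> on \<open>[a,1)\<close>, where \<open>h = w / (1 - a)\<close>. Its density is \<open>a\<^sup>2 + 2 w\<close>.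
\<close>

definition threshold_value :: "real \<Rightarrow> real \<Rightarrow> real" where
  "threshold_value a w
    = a ^ 5 + 2 * a ^ 3 * w + 3 * a * w\<^sup>2 + (1 - a) * w\<^sup>2 + 3 * w\<^sup>2 * (a\<^sup>2 + w) / (1 - a)"

lemma star_value_minus_threshold_value:
  fixes a s :: real
  assumes "a < 1" "s \<le> 1" and w: "w = (s * (2 - s) - a\<^sup>2) / 2"
  defines "e \<equiv> a - s"
  shows "4 * ((1 - a) * (star_value (s * (2 - s)) - threshold_value a w))
    = e\<^sup>2 * (2 * (1 - a) * w * (2 + s) + e\<^sup>2 * (1 - 7 * a + 3 * a\<^sup>2 + 4 * (1 - a) * e + 3 / 2 * e\<^sup>2))"
proof -
  have s_eq: "s = a - e"
    by (simp add: e_def)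
  have scaled: "(1 - a) * threshold_value a w
      = (1 - a) * (a ^ 5 + 2 * a ^ 3 * w + 3 * a * w\<^sup>2 + (1 - a) * w\<^sup>2) + 3 * w\<^sup>2 * (a\<^sup>2 + w)"
    unfolding threshold_value_def using assms(1) by (subst distrib_left) simp
  show ?thesis
    unfolding right_diff_distrib[of _ _ "threshold_value a w"] scaled star_value_star_density[OF assms(2)]
    unfolding w s_eq by (simp add: field_simps eval_nat_numeral)
qed

lemma threshold_value_le_star_value:
  fixes a w :: real
  assumes a: "0 < a" "a < 1" and w: "w \<le> a * (1 - a)" "7 * a ^ 3 \<le> 4 * (1 - a) * w"
  shows "threshold_value a w \<le> star_value (a\<^sup>2 + 2 * w)"
proof -
  have "0 < (1 - a) * w"
    using w(2) zero_less_power[OF a(1), of 3] by linarith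
  then have w_pos: "0 < w"
    using a by (simp add: zero_less_mult_iff)
  have mass: "a\<^sup>2 + 2 * w \<le> 1 - (1 - a)\<^sup>2"
    using w by (simp add: power2_eq_square algebra_simps)
  have "0 \<le> a\<^sup>2 + 2 * w" "a\<^sup>2 + 2 * w \<le> 1"
    using w_pos mass by (auto simp: order_trans[OF mass])
  then obtain s where s: "0 \<le> s" "s \<le> 1" and mass_eq: "a\<^sup>2 + 2 * w = s * (2 - s)"
    by (rule star_density_cases)
  have "(1 - a)\<^sup>2 \<le> (1 - s)\<^sup>2"
    using mass unfolding mass_eq by (simp add: power2_eq_square algebra_simps)
  then have "s \<le> a"
    using s power2_le_imp_le[of "1 - a" "1 - s"] by simp
  define e where "e = a - s"
  have e: "0 \<le> e" "e \<le> a"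
    using \<open>s \<le> a\<close> s by (auto simp: e_def)
  have "7 * a * e\<^sup>2 \<le> 7 * a * a\<^sup>2"
    using a e by (intro mult_left_mono power_mono) auto
  also have "\<dots> \<le> 2 * (1 - a) * w * 2"
    using w(2) by (simp add: power2_eq_square power3_eq_cube algebra_simps)
  also have "\<dots> \<le> 2 * (1 - a) * w * (2 + s)"
    using a w_pos s by (intro mult_left_mono) auto
  finally have "7 * a * e\<^sup>2 \<le> 2 * (1 - a) * w * (2 + s)" .
  moreover have "0 \<le> e\<^sup>2 * (1 + 3 * a\<^sup>2 + 4 * (1 - a) * e + 3 / 2 * e\<^sup>2)"
    using a e by simp
  ultimately have "0 \<le> 2 * (1 - a) * w * (2 + s)
      + e\<^sup>2 * (1 - 7 * a + 3 * a\<^sup>2 + 4 * (1 - a) * e + 3 / 2 * e\<^sup>2)"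
    by (simp add: algebra_simps)
  then have "0 \<le> 4 * ((1 - a) * (star_value (s * (2 - s)) - threshold_value a w))"
    using star_value_minus_threshold_value[OF a(2) s(2), of w] mass_eq by (simp add: e_def)
  then show ?thesis
    using a by (simp add: mass_eq zero_le_mult_iff)
qed

lemma quadratic_le_clique_value:
  assumes "0 \<le> u"
  shows "1 + 5 * u + 7 * u\<^sup>2 \<le> clique_value (1 + 2 * u)"
proof (rule le_clique_valueI)
  have "(1 + 2 * u) ^ 5 - (1 + 5 * u + 7 * u\<^sup>2)\<^sup>2 = u\<^sup>2 + 10 * u ^ 3 + 31 * u ^ 4 + 32 * u ^ 5"
    by algebra
  also have "\<dots> \<ge> 0"
    using assms by simp
  finally show "(1 + 5 * u + 7 * u\<^sup>2)\<^sup>2 \<le> (1 + 2 * u) ^ 5"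
    by simp
qed (use assms in simp)

lemma cubic_le_clique_value:
  assumes "0 \<le> u" "u \<le> 7"
  shows "1 + 5 * u + 15 / 2 * u\<^sup>2 + 5 / 4 * u ^ 3 \<le> clique_value (1 + 2 * u)" (is "?n \<le> _")
proof (rule le_clique_valueI)
  have "16 * ((1 + 2 * u) ^ 5 - ?n\<^sup>2) = 40 * u ^ 3 + 180 * u ^ 4 + 37 * u ^ 5 + 25 * u ^ 5 * (7 - u)"
    by (simp add: field_simps eval_nat_numeral)
  also have "\<dots> \<ge> 0"
    using assms by simp
  finally show "?n\<^sup>2 \<le> (1 + 2 * u) ^ 5"
    by simp
qed (use assms in simp)

section \<open>The polynomial inequality\<close>

text \<open>
  The bound for \<open>S\<close> divided by \<open>a\<^sup>5\<close>, in the scaled variables \<open>r = (1 - a) / a\<close>, \<open>y = x / a\<^sup>2\<close>,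
  \<open>b / a\<^sup>2\<close>, \<open>q / a\<^sup>3\<close> and \<open>G / a\<^sup>3\<close>; likewise \<open>mixed_value\<close> is \<open>threshold_value\<close> divided by \<open>a\<^sup>5\<close>.
\<close>

definition cut_bound :: "real \<Rightarrow> real \<Rightarrow> real \<Rightarrow> real \<Rightarrow> real \<Rightarrow> real" where
  "cut_bound r y b Q G
    = 1 + 4 * y + 3 * y\<^sup>2 - r * y\<^sup>2 + y ^ 3 + 2 * (r * y - 1) * Q + (2 + 2 * y + b) * G"

definition middle_bound :: "real \<Rightarrow> real \<Rightarrow> real \<Rightarrow> real" where
  "middle_bound r y b
    = 1 + 4 * y + b + 3 * y\<^sup>2 + 2 * y * b + b\<^sup>2 + y ^ 3 + r * (y * (b - y))"

definition mixed_value :: "real \<Rightarrow> real \<Rightarrow> real" where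
  "mixed_value r u = 1 + 2 * u + 3 * u\<^sup>2 + r * u\<^sup>2 + 3 * u\<^sup>2 * (1 + u) / r"

lemma cut_bound_le_clique_value:
  assumes y: "0 \<le> y" "y \<le> b" "b \<le> r" "r * y \<le> 1" and Q: "y / 2 \<le> Q" and G: "G \<le> b"
  shows "cut_bound r y b Q G \<le> clique_value (1 + y + b)"
proof -
  define u where "u = (y + b) / 2"
  have u: "0 \<le> u" "1 + y + b = 1 + 2 * u"
    using y by (auto simp: u_def)
  have "(r * y - 1) * Q \<le> (r * y - 1) * (y / 2)"
    using y Q by (intro mult_left_mono_neg) auto
  moreover have "(2 + 2 * y + b) * G \<le> (2 + 2 * y + b) * b"
    using y G by (intro mult_left_mono) auto
  ultimately have "cut_bound r y b Q G \<le> 1 + (3 * y + 2 * b) + (3 * y\<^sup>2 + y ^ 3 + 2 * y * b + b\<^sup>2)"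
    by (simp add: cut_bound_def algebra_simps power2_eq_square)
  also have "\<dots> \<le> 1 + 5 * u + 7 * u\<^sup>2"
  proof -
    have "y * y \<le> r * y"
      using y by (intro mult_right_mono) auto
    then have "y\<^sup>2 \<le> 1"
      using y by (simp add: power2_eq_square)
    then have "y ^ 3 \<le> y\<^sup>2"
      using y by (simp add: abs_square_le_1 power_decreasing)
    moreover have "0 \<le> (b - y) * (b + 3 * y)"
      using y by simp
    ultimately have "3 * y\<^sup>2 + y ^ 3 + 2 * y * b + b\<^sup>2 \<le> 7 * u\<^sup>2"
      by (simp add: u_def power2_eq_square field_simps)
    moreover have "3 * y + 2 * b \<le> 5 * u"
      using y by (simp add: u_def field_simps)
    ultimately show ?thesis
      by linarith
  qed
  also have "\<dots> \<le> clique_value (1 + 2 * u)"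
    using u by (intro quadratic_le_clique_value) simp
  finally show ?thesis
    by (simp add: u)
qed

lemma cut_bound_le_mixed_value:
  assumes y: "0 \<le> y" "y \<le> b" "3 + 2 * y + b \<le> r * y" and r: "0 < r"
    and Q: "Q \<le> y - y\<^sup>2 / (2 * r)" and G: "Q + G / 2 \<le> b" and u: "u = (y + b) / 2"
  shows "cut_bound r y b Q G \<le> mixed_value r u"
proof -
  define d where "d = u - y"
  have d: "0 \<le> d" and b: "b = y + 2 * d" and u_eq: "u = y + d"
    using y u by (auto simp: d_def field_simps)
  have "1 * y \<le> r * y"
    using y by linarith
  then have "1 \<le> r"
    using y by (cases "y = 0") auto
  have "cut_bound r y b Q G = 1 + 4 * y + 3 * y\<^sup>2 - r * y\<^sup>2 + y ^ 3
      + 2 * ((r * y - 3 - 2 * y - b) * Q) + (2 + 2 * y + b) * (G + 2 * Q)"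
    by (simp add: cut_bound_def algebra_simps)
  also have "\<dots> \<le> 1 + 4 * y + 3 * y\<^sup>2 - r * y\<^sup>2 + y ^ 3
      + 2 * ((r * y - 3 - 2 * y - b) * (y - y\<^sup>2 / (2 * r))) + (2 + 2 * y + b) * (2 * b)"
    using y Q G by (intro add_mono mult_left_mono order_refl) auto
  also have "2 * ((r * y - 3 - 2 * y - b) * (y - y\<^sup>2 / (2 * r)))
      = 2 * (r * y - 3 - 2 * y - b) * y - y ^ 3 + (3 + 2 * y + b) * y\<^sup>2 / r"
    using r by (simp add: field_simps eval_nat_numeral)
  also have "1 + 4 * y + 3 * y\<^sup>2 - r * y\<^sup>2 + y ^ 3
      + (2 * (r * y - 3 - 2 * y - b) * y - y ^ 3 + (3 + 2 * y + b) * y\<^sup>2 / r) + (2 + 2 * y + b) * (2 * b)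
      = 1 - 2 * y - y\<^sup>2 + r * y\<^sup>2 + 4 * b + 2 * y * b + 2 * b\<^sup>2 + (3 + 2 * y + b) * y\<^sup>2 / r"
    by (simp add: algebra_simps power2_eq_square)
  also have "\<dots> \<le> 1 + 2 * u + 3 * u\<^sup>2 + r * u\<^sup>2 + 3 * u\<^sup>2 * (1 + u) / r"
  proof (rule add_mono)
    have "0 \<le> d * (2 * (r * y - (3 + 2 * y + b)) + (r - 1) * d)"
      using y d \<open>1 \<le> r\<close> by simp
    then show "1 - 2 * y - y\<^sup>2 + r * y\<^sup>2 + 4 * b + 2 * y * b + 2 * b\<^sup>2
        \<le> 1 + 2 * u + 3 * u\<^sup>2 + r * u\<^sup>2"
      unfolding b u_eq by (simp add: algebra_simps power2_eq_square)
    have "(3 + 2 * y + b) * y\<^sup>2 \<le> (3 + 3 * u) * u\<^sup>2"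
      using y d by (intro mult_mono power_mono) (auto simp: b u_eq)
    then show "(3 + 2 * y + b) * y\<^sup>2 / r \<le> 3 * u\<^sup>2 * (1 + u) / r"
      using r by (intro divide_right_mono) (auto simp: algebra_simps)
  qed
  finally show ?thesis
    unfolding mixed_value_def .
qed

lemma cut_bound_le_middle_bound:
  assumes y: "1 \<le> r * y" "r * y \<le> 3 + 2 * y + b" and G: "G \<le> b" "Q + G / 2 \<le> b"
  shows "cut_bound r y b Q G \<le> middle_bound r y b"
proof -
  \<comment> \<open>Splitting the coefficient of \<open>G\<close> this way makes the coefficient of \<open>Q\<close> vanish.\<close>
  have "(2 + 2 * y + b) * G = (r * y - 1) * G + (3 + 2 * y + b - r * y) * G"
    by (simp add: algebra_simps)
  also have "\<dots> \<le> (r * y - 1) * (2 * (b - Q)) + (3 + 2 * y + b - r * y) * b"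
    using y G by (intro add_mono mult_left_mono) auto
  finally show ?thesis
    by (simp add: cut_bound_def middle_bound_def algebra_simps power2_eq_square)
qed

lemma middle_bound_le_double_square:
  fixes r y b :: real
  assumes y: "0 \<le> y" "y \<le> b" "b \<le> r" "r * y \<le> 3 + 2 * y + b" and r: "7 \<le> r"
  shows "middle_bound r y b \<le> 2 * (1 + y + b)\<^sup>2"
proof -
  have "(r - 2) * y \<le> (r - 2) * 2"
    using y r by (simp add: algebra_simps)
  then have "y \<le> 2"
    by (rule mult_left_le_imp_le) (use r in simp)
  then have "y * y\<^sup>2 \<le> 2 * y\<^sup>2"
    by (rule mult_right_mono) simp
  moreover have "y\<^sup>2 \<le> y * b"
    using y by (simp add: power2_eq_square mult_left_mono)
  moreover have "(r * y) * (b - y) \<le> (3 + 2 * y + b) * (b - y)"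
    using y by (intro mult_right_mono) auto
  ultimately show ?thesis
    using y by (simp add: middle_bound_def power2_eq_square power3_eq_cube algebra_simps)
qed

lemma middle_bound_gain_le:
  fixes u v :: real
  assumes "0 \<le> u" "0 \<le> v"
  shows "v * (10 * u - 3 - 12 * v) \<le> 3 / 2 * u\<^sup>2 + u ^ 3 / 4"
proof (cases "10 * u \<le> 3")
  case True
  then have "v * (10 * u - 3 - 12 * v) \<le> 0"
    using assms by (intro mult_nonneg_nonpos) auto
  also have "\<dots> \<le> 3 / 2 * u\<^sup>2 + u ^ 3 / 4"
    using assms by simp
  finally show ?thesis .
next
  case False
  have "0 \<le> (10 * u - 3 - 24 * v)\<^sup>2"
    by simp
  moreover have "(10 * u - 3)\<^sup>2 \<le> 72 * u\<^sup>2 + 12 * u ^ 3"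
  proof -
    have "0 \<le> u * (6 * u - 7)\<^sup>2"
      using assms by simp
    then show ?thesis
      using False by (simp add: power2_eq_square power3_eq_cube algebra_simps)
  qed
  ultimately show ?thesis
    by (simp add: power2_eq_square algebra_simps)
qed

lemma middle_bound_le_clique_value:
  assumes y: "0 \<le> y" "y \<le> b" "b \<le> r" and r: "r \<le> 7"
  shows "middle_bound r y b \<le> clique_value (1 + y + b)"
proof -
  define u v where "u = (y + b) / 2" and "v = (b - y) / 2"
  have uv: "y = u - v" "b = u + v"
    by (auto simp: u_def v_def field_simps)
  have u: "0 \<le> u" "u \<le> 7" and v: "0 \<le> v" "v \<le> u"
    using y r by (auto simp: u_def v_def)
  have "r * (y * (b - y)) \<le> 7 * (y * (b - y))"
    using y r by (intro mult_right_mono) auto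
  then have "middle_bound r y b
      \<le> 1 + 5 * u + 6 * u\<^sup>2 + (u - v) ^ 3 + v * (10 * u - 3 - 12 * v)"
    unfolding middle_bound_def uv by (simp add: power2_eq_square algebra_simps)
  also have "\<dots> \<le> 1 + 5 * u + 6 * u\<^sup>2 + u ^ 3 + (3 / 2 * u\<^sup>2 + u ^ 3 / 4)"
    using u v by (intro add_mono power_mono middle_bound_gain_le) auto
  also have "\<dots> = 1 + 5 * u + 15 / 2 * u\<^sup>2 + 5 / 4 * u ^ 3"
    by simp
  also have "\<dots> \<le> clique_value (1 + 2 * u)"
    using u by (rule cubic_le_clique_value)
  finally show ?thesis
    by (simp add: uv add.commute)
qed

lemma scaled_middle_bound_le_star_value:
  assumes a: "0 < a" and r: "r = (1 - a) / a" "7 \<le> r"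
    and y: "0 \<le> y" "y \<le> b" "b \<le> r" "r * y \<le> 3 + 2 * y + b" and c: "c = a\<^sup>2 * (1 + y + b)" "c \<le> 1"
  shows "a ^ 5 * middle_bound r y b \<le> star_value c"
proof -
  have "8 * a \<le> 1"
    using r(2) a by (simp add: r(1) field_simps)
  have "a ^ 5 * middle_bound r y b \<le> a ^ 5 * (2 * (1 + y + b)\<^sup>2)"
    using a r y by (intro mult_left_mono middle_bound_le_double_square) auto
  also have "\<dots> = (8 * a) * c\<^sup>2 / 4"
    by (simp add: c(1) eval_nat_numeral algebra_simps)
  also have "\<dots> \<le> c\<^sup>2 / 4"
    using \<open>8 * a \<le> 1\<close> a by (intro divide_right_mono mult_left_le_one_le) auto
  also have "\<dots> \<le> star_value c"
    using c y by (intro quarter_square_le_star_value) auto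
  finally show ?thesis .
qed

lemma scaled_mixed_value_le_star_value:
  assumes a: "0 < a" "a < 1" and r: "r = (1 - a) / a" and u: "u \<le> r" "7 \<le> 4 * r * u"
  shows "a ^ 5 * mixed_value r u \<le> star_value (a\<^sup>2 * (1 + 2 * u))"
proof -
  have ar: "1 - a = a * r"
    using a r by simp
  have "0 < r"
    using a r by simp
  define w where "w = a\<^sup>2 * u"
  have "a ^ 5 * mixed_value r u = threshold_value a w"
    unfolding mixed_value_def threshold_value_def ar w_def
    using a \<open>0 < r\<close> by (simp add: field_simps eval_nat_numeral)
  also have "\<dots> \<le> star_value (a\<^sup>2 + 2 * w)"
  proof (rule threshold_value_le_star_value[OF a])
    have "a\<^sup>2 * u \<le> a\<^sup>2 * r"
      using u by (intro mult_left_mono) auto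
    then show "w \<le> a * (1 - a)"
      by (simp add: w_def ar power2_eq_square)
    have "a ^ 3 * 7 \<le> a ^ 3 * (4 * r * u)"
      using a u by (intro mult_left_mono) auto
    then show "7 * a ^ 3 \<le> 4 * (1 - a) * w"
      by (simp add: w_def ar power2_eq_square power3_eq_cube mult_ac)
  qed
  also have "a\<^sup>2 + 2 * w = a\<^sup>2 * (1 + 2 * u)"
    by (simp add: w_def algebra_simps)
  finally show ?thesis .
qed

lemma scaled_cut_bound_le_star_value:
  assumes a: "0 < a" "a < 1" and r: "r = (1 - a) / a"
    and y: "0 \<le> y" "y \<le> b" "b \<le> r" "3 + 2 * y + b \<le> r * y"
    and Q: "Q \<le> y - y\<^sup>2 / (2 * r)" and G: "Q + G / 2 \<le> b"
  shows "a ^ 5 * cut_bound r y b Q G \<le> star_value (a\<^sup>2 * (1 + y + b))"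
proof -
  define u where "u = (y + b) / 2"
  have "0 < r"
    using a r by simp
  have u: "y \<le> u" "u \<le> r" and mass: "1 + y + b = 1 + 2 * u"
    using y by (auto simp: u_def)
  have "r * y \<le> r * u"
    using u \<open>0 < r\<close> by simp
  then have "7 \<le> 4 * r * u"
    using y by linarith
  have "a ^ 5 * cut_bound r y b Q G \<le> a ^ 5 * mixed_value r u"
    using a y \<open>0 < r\<close> Q G u_def by (intro mult_left_mono cut_bound_le_mixed_value) auto
  also have "\<dots> \<le> star_value (a\<^sup>2 * (1 + y + b))"
    unfolding mass using a r u(2) \<open>7 \<le> 4 * r * u\<close> by (rule scaled_mixed_value_le_star_value)
  finally show ?thesis .
qed

lemma scaled_cut_bound_le:
  assumes a: "0 < a" "a < 1" and r: "r = (1 - a) / a" and y: "0 \<le> y" "y \<le> b" "b \<le> r"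
    and Q: "y / 2 \<le> Q" "Q \<le> y - y\<^sup>2 / (2 * r)" and G: "G \<le> b" "Q + G / 2 \<le> b"
    and c: "c = a\<^sup>2 * (1 + y + b)" "c \<le> 1"
  shows "a ^ 5 * cut_bound r y b Q G \<le> extremal_value c"
proof -
  have clique: "a ^ 5 * cut_bound r y b Q G \<le> clique_value c"
    if "cut_bound r y b Q G \<le> clique_value (1 + y + b)"
    using that a by (simp add: c(1) clique_value_scale)
  consider (small) "r * y \<le> 1" | (large) "3 + 2 * y + b \<le> r * y"
    | (middle_star) "1 \<le> r * y" "r * y \<le> 3 + 2 * y + b" "7 \<le> r"
    | (middle_clique) "1 \<le> r * y" "r * y \<le> 3 + 2 * y + b" "r \<le> 7"
    by linarith
  then show ?thesis
  proof cases
    case small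
    then show ?thesis
      using clique cut_bound_le_clique_value y Q G
      by (simp add: extremal_value_def le_max_iff_disj)
  next
    case large
    then have "a ^ 5 * cut_bound r y b Q G \<le> star_value c"
      unfolding c(1) using a r y Q G by (intro scaled_cut_bound_le_star_value)
    then show ?thesis
      by (simp add: extremal_value_def)
  next
    case middle_star
    have "a ^ 5 * cut_bound r y b Q G \<le> a ^ 5 * middle_bound r y b"
      using middle_star G a by (intro mult_left_mono cut_bound_le_middle_bound) auto
    also have "\<dots> \<le> star_value c"
      using a(1) r middle_star y c by (intro scaled_middle_bound_le_star_value)
    finally show ?thesis
      by (simp add: extremal_value_def)
  next
    case middle_clique
    then show ?thesis
      using clique[OF order_trans[OF cut_bound_le_middle_bound middle_bound_le_clique_value]] y G
      by (simp add: extremal_value_def le_max_iff_disj)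
  qed
qed

lemma cut_polynomial_le:
  fixes a x b q G :: real
  assumes a: "0 < a" "a < 1" and x: "0 \<le> x" "x \<le> b" and b: "b \<le> a * (1 - a)"
    and q: "a * x / 2 \<le> q" "q \<le> a * x - x\<^sup>2 / (2 * (1 - a))"
    and G: "G \<le> a * b" "q + G / 2 \<le> a * b" and c: "c = a\<^sup>2 + x + b"
  shows "a ^ 5 + 4 * a ^ 3 * x + 3 * a * x\<^sup>2 - (1 - a) * x\<^sup>2 + x ^ 3 / a
      + 2 * ((1 - a) * x / a - a\<^sup>2) * q + (2 * a\<^sup>2 + 2 * x + b) * G
    \<le> extremal_value c" (is "?lhs \<le> _")
proof -
  define r y b' Q G' where "r = (1 - a) / a" and "y = x / a\<^sup>2" and "b' = b / a\<^sup>2"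
    and "Q = q / a ^ 3" and "G' = G / a ^ 3"
  have unscale: "x = a\<^sup>2 * y" "b = a\<^sup>2 * b'" "q = a ^ 3 * Q" "G = a ^ 3 * G'" "1 - a = a * r"
    using a by (simp_all add: y_def b'_def Q_def G'_def r_def)
  have "0 < r"
    using a by (simp add: r_def)
  have "?lhs = a ^ 5 * cut_bound r y b' Q G'"
    unfolding unscale cut_bound_def using a by (simp add: field_simps eval_nat_numeral)
  also have "\<dots> \<le> extremal_value c"
  proof (rule scaled_cut_bound_le[OF a r_def])
    show "0 \<le> y" "y \<le> b'"
      using x a by (auto simp: y_def b'_def divide_right_mono)
    have "a\<^sup>2 * b' \<le> a\<^sup>2 * r"
      using b by (simp add: unscale power2_eq_square)
    then show "b' \<le> r"
      using a by simp
    have cancel: "u \<le> v" if "a ^ 3 * u \<le> a ^ 3 * v" for u v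
      using that a by (simp only: mult_le_cancel_left_pos zero_less_power)
    show "y / 2 \<le> Q"
      by (rule cancel) (use q(1) in \<open>simp add: unscale power2_eq_square power3_eq_cube mult.assoc\<close>)
    show "Q \<le> y - y\<^sup>2 / (2 * r)"
    proof (rule cancel)
      show "a ^ 3 * Q \<le> a ^ 3 * (y - y\<^sup>2 / (2 * r))"
        using q(2) a \<open>0 < r\<close> unfolding unscale by (simp add: field_simps eval_nat_numeral)
    qed
    show "G' \<le> b'"
      by (rule cancel) (use G(1) in \<open>simp add: unscale power2_eq_square power3_eq_cube mult.assoc\<close>)
    show "Q + G' / 2 \<le> b'"
      by (rule cancel) (use G(2) in \<open>simp add: unscale power2_eq_square power3_eq_cube algebra_simps\<close>)
    show "c = a\<^sup>2 * (1 + y + b')"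
      by (simp add: c unscale algebra_simps)
    have "c \<le> 1 - (1 - a)\<^sup>2"
      using x b by (simp add: c power2_eq_square algebra_simps)
    then show "c \<le> 1"
      using zero_le_power2[of "1 - a"] by linarith
  qed
  finally show ?thesis .
qed

section \<open>Integrals over intervals\<close>

lemma has_integral_le_interior:
  fixes f g :: "real \<Rightarrow> real"
  assumes "(f has_integral i) {s..t}" "(g has_integral j) {s..t}"
    and "\<And>x. s < x \<Longrightarrow> x < t \<Longrightarrow> f x \<le> g x"
  shows "i \<le> j"
  using assms has_integral_le[of f i "{s<..<t}" g j]
  by (simp add: has_integral_open_interval flip: box_real)

lemma set_integrable_lborel_bounded:
  fixes f :: "'a::euclidean_space \<Rightarrow> real"
  assumes "f \<in> borel_measurable borel" "A \<in> sets borel" "bounded A" "\<And>x. x \<in> A \<Longrightarrow> \<bar>f x\<bar> \<le> B"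
  shows "set_integrable lborel A f"
  unfolding set_integrable_def
  using assms emeasure_bounded_finite[of A]
  by (intro integrableI_bounded_set_indicator[where B = B]) auto

lemma integrable_on_Icc_bounded:
  fixes f :: "real \<Rightarrow> real"
  assumes "f \<in> borel_measurable borel" "\<And>x. x \<in> {s..t} \<Longrightarrow> \<bar>f x\<bar> \<le> B"
  shows "f integrable_on {s..t}"
  using assms by (intro set_borel_integral_eq_integral set_integrable_lborel_bounded) auto

lemma lborel_integral_indicator_Icc:
  fixes f :: "real \<Rightarrow> real"
  assumes "f \<in> borel_measurable borel" "\<And>x. x \<in> {s..t} \<Longrightarrow> \<bar>f x\<bar> \<le> B"
  shows "(\<integral>x. indicator {s..t} x * f x \<partial>lborel) = integral {s..t} f"
proof -
  have "set_integrable lborel {s..t} f"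
    using assms by (intro set_integrable_lborel_bounded) auto
  from set_borel_integral_eq_integral(2)[OF this] show ?thesis
    by (simp add: set_lebesgue_integral_def)
qed

lemma has_integral_integral_swap:
  fixes f :: "real \<Rightarrow> real \<Rightarrow> real"
  assumes meas: "case_prod f \<in> borel_measurable borel"
    and bound: "\<And>x y. x \<in> {s..t} \<Longrightarrow> y \<in> {u..v} \<Longrightarrow> \<bar>f x y\<bar> \<le> B"
  shows "((\<lambda>x. integral {u..v} (f x)) has_integral
    integral {u..v} (\<lambda>y. integral {s..t} (\<lambda>x. f x y))) {s..t}"
proof -
  define g where "g x y = indicator {s..t} x * indicator {u..v} y * f x y" for x y
  have [measurable]: "case_prod f \<in> borel_measurable (borel \<Otimes>\<^sub>M borel)"
    using meas by (simp add: borel_prod)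
  have "set_integrable lborel ({s..t} \<times> {u..v}) (case_prod f)"
    using meas bound by (intro set_integrable_lborel_bounded[where B = B] bounded_Times)
      (auto intro: borel_closed closed_Times)
  then have g_int: "integrable (lborel \<Otimes>\<^sub>M lborel) (case_prod g)"
    by (simp add: set_integrable_def lborel_prod g_def[abs_def] indicator_times case_prod_beta')
  have rows: "(\<integral>y. g x y \<partial>lborel) = indicator {s..t} x *\<^sub>R integral {u..v} (f x)" for x
    using lborel_integral_indicator_Icc[of "f x" u v B] bound
    by (cases "x \<in> {s..t}") (simp_all add: g_def)
  have columns: "(\<integral>x. g x y \<partial>lborel) = indicator {u..v} y *\<^sub>R integral {s..t} (\<lambda>x. f x y)" for y
    using lborel_integral_indicator_Icc[of "\<lambda>x. f x y" s t B] bound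
    by (cases "y \<in> {u..v}") (simp_all add: g_def)
  have "set_integrable lborel {s..t} (\<lambda>x. integral {u..v} (f x))"
    using lborel_pair.integrable_fst[OF g_int] by (simp add: set_integrable_def rows)
  moreover have "set_integrable lborel {u..v} (\<lambda>y. integral {s..t} (\<lambda>x. f x y))"
    using lborel_pair.integrable_snd[OF g_int] by (simp add: set_integrable_def columns)
  moreover have "(LBINT x:{s..t}. integral {u..v} (f x)) = (LBINT y:{u..v}. integral {s..t} (\<lambda>x. f x y))"
    using lborel_pair.Fubini_integral[OF g_int] by (simp add: set_lebesgue_integral_def rows columns)
  ultimately show ?thesis
    by (simp add: set_borel_integral_eq_integral has_integral_integrable_integral)
qed

lemma has_field_derivative_indefinite_integral:
  fixes f :: "real \<Rightarrow> real"
  assumes "f integrable_on {s..t}" "x \<in> {s<..<t}" "isCont f x"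
  shows "((\<lambda>u. integral {s..u} f) has_real_derivative f x) (at x)"
proof -
  have "((\<lambda>u. integral {s..u} f) has_vector_derivative f x) (at x within ({s..t} - {}))"
    using assms by (intro integral_has_vector_derivative_continuous_at)
      (auto intro: continuous_at_imp_continuous_within)
  moreover have "at x within {s..t} = at x"
    using assms by (intro at_within_Icc_at) auto
  ultimately show ?thesis
    by (simp add: has_real_derivative_iff_has_vector_derivative)
qed

lemma has_integral_min:
  fixes a m :: real
  assumes "0 \<le> m" "m \<le> a"
  shows "((\<lambda>x. min x m) has_integral a * m - m\<^sup>2 / 2) {0..a}"
proof -
  have "((\<lambda>x. x) has_integral m\<^sup>2 / 2) {0..m}"
    using ident_has_integral[of 0 m] assms by simp
  then have "((\<lambda>x. min x m) has_integral m\<^sup>2 / 2) {0..m}"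
    by (rule has_integral_eq[rotated]) auto
  moreover have "((\<lambda>_. m) has_integral (a - m) * m) {m..a}"
    using has_integral_const_real[of m m a] assms by simp
  then have "((\<lambda>x. min x m) has_integral (a - m) * m) {m..a}"
    by (rule has_integral_eq[rotated]) auto
  ultimately have "((\<lambda>x. min x m) has_integral m\<^sup>2 / 2 + (a - m) * m) {0..a}"
    using assms by (intro has_integral_combine) auto
  also have "m\<^sup>2 / 2 + (a - m) * m = a * m - m\<^sup>2 / 2"
    by (simp add: power2_eq_square algebra_simps)
  finally show ?thesis .
qed

section \<open>Nonincreasing degree functions\<close>

locale sorted_degree =
  fixes l :: "real \<Rightarrow> real" and Z :: "real set"
  assumes finite_Z: "finite Z"
    and isCont_l: "x \<in> {0<..<1} - Z \<Longrightarrow> isCont l x"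
    and antimono_l: "antimono l"
    and l_nonneg: "0 \<le> l x"
    and l_le_1: "l x \<le> 1"
begin

definition L :: "real \<Rightarrow> real" where
  "L t = integral {0..t} l"

definition Lsq :: "real \<Rightarrow> real" where
  "Lsq t = integral {0..t} (\<lambda>x. (l x)\<^sup>2)"

lemma l_antimono: "x \<le> y \<Longrightarrow> l y \<le> l x"
  using antimono_l by (rule antimonoD)

lemma borel_measurable_l [measurable]: "l \<in> borel_measurable borel"
proof -
  have "mono (\<lambda>x. - l x)"
    using l_antimono by (auto simp: mono_def)
  then have "(\<lambda>x. - l x) \<in> borel_measurable borel"
    by (rule borel_measurable_mono)
  then show ?thesis
    by simp
qed

lemma integrable_l: "l integrable_on {s..t}"
  using l_nonneg l_le_1 by (intro integrable_on_Icc_bounded[where B = 1]) auto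

lemma integrable_l_sq: "(\<lambda>x. (l x)\<^sup>2) integrable_on {s..t}"
  using l_nonneg l_le_1 by (intro integrable_on_Icc_bounded[where B = 1]) (auto simp: power_le_one)

lemma L_0 [simp]: "L 0 = 0"
  by (simp add: L_def)

lemma Lsq_0 [simp]: "Lsq 0 = 0"
  by (simp add: Lsq_def)

lemma has_integral_l: "0 \<le> s \<Longrightarrow> s \<le> t \<Longrightarrow> (l has_integral L t - L s) {s..t}"
  using Henstock_Kurzweil_Integration.integral_combine[of 0 s t l] integrable_l
  by (simp add: L_def has_integral_integrable_integral)

lemma has_integral_l_sq: "0 \<le> s \<Longrightarrow> s \<le> t \<Longrightarrow> ((\<lambda>x. (l x)\<^sup>2) has_integral Lsq t - Lsq s) {s..t}"
  using Henstock_Kurzweil_Integration.integral_combine[of 0 s t "\<lambda>x. (l x)\<^sup>2"] integrable_l_sq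
  by (simp add: Lsq_def has_integral_integrable_integral)

lemma const_le_L_diff:
  assumes "0 \<le> s" "s \<le> t" "\<And>x. s < x \<Longrightarrow> x < t \<Longrightarrow> k \<le> l x"
  shows "(t - s) * k \<le> L t - L s"
  using assms has_integral_const_real[of k s t]
  by (intro has_integral_le_interior[OF _ has_integral_l, where f = "\<lambda>_. k"]) auto

lemma L_diff_le_const:
  assumes "0 \<le> s" "s \<le> t" "\<And>x. s < x \<Longrightarrow> x < t \<Longrightarrow> l x \<le> k"
  shows "L t - L s \<le> (t - s) * k"
  using assms has_integral_const_real[of k s t]
  by (intro has_integral_le_interior[OF has_integral_l, where g = "\<lambda>_. k"]) auto

lemma L_nonneg: "0 \<le> L t"
  unfolding L_def using l_nonneg by (intro integral_nonneg integrable_l)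

lemma L_mono: "s \<le> t \<Longrightarrow> L s \<le> L t"
  using const_le_L_diff[of s t 0] l_nonneg L_nonneg[of t] by (cases "0 \<le> s") (auto simp: L_def)

lemma L_le: "0 \<le> t \<Longrightarrow> L t \<le> t"
  using L_diff_le_const[of 0 t 1] l_le_1 by simp

lemma mult_l_le_L: "0 \<le> t \<Longrightarrow> t * l t \<le> L t"
  using const_le_L_diff[of 0 t "l t"] l_antimono by simp

lemma L_diff_le: "0 \<le> s \<Longrightarrow> s \<le> t \<Longrightarrow> L t - L s \<le> (t - s) * l s"
  using L_diff_le_const[of s t "l s"] l_antimono by simp

lemma continuous_on_L: "0 \<le> s \<Longrightarrow> continuous_on {s..t} L"
  unfolding L_def
  by (rule continuous_on_subset[OF indefinite_integral_continuous_1[OF integrable_l]]) auto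

lemma continuous_on_Lsq: "continuous_on {0..t} Lsq"
  unfolding Lsq_def by (rule indefinite_integral_continuous_1[OF integrable_l_sq])

lemma DERIV_L: "x \<in> {0<..<1} - Z \<Longrightarrow> (L has_real_derivative l x) (at x)"
  unfolding L_def[abs_def]
  by (rule has_field_derivative_indefinite_integral[OF integrable_l[of 0 1]]) (auto intro: isCont_l)

lemma DERIV_Lsq: "x \<in> {0<..<1} - Z \<Longrightarrow> (Lsq has_real_derivative (l x)\<^sup>2) (at x)"
  unfolding Lsq_def[abs_def]
  by (rule has_field_derivative_indefinite_integral[OF integrable_l_sq[of 0 1]])
    (auto intro!: continuous_intros isCont_l)

lemma has_integral_DERIV:
  assumes "0 \<le> s" "s \<le> t" "t \<le> 1" "continuous_on {s..t} F"
    and "\<And>x. x \<in> {0<..<1} - Z \<Longrightarrow> (F has_real_derivative f x) (at x)"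
  shows "(f has_integral F t - F s) {s..t}"
  using assms finite_Z
  by (intro fundamental_theorem_of_calculus_interior_strong)
    (auto simp flip: has_real_derivative_iff_has_vector_derivative)

lemma borel_measurable_L [measurable]: "L \<in> borel_measurable borel"
  by (intro borel_measurable_mono monoI L_mono)

lemma integrable_L_sq: "(\<lambda>x. L x * (l x)\<^sup>2) integrable_on {s..t}"
proof (rule integrable_on_Icc_bounded)
  show "\<bar>L x * (l x)\<^sup>2\<bar> \<le> L t * 1" if "x \<in> {s..t}" for x
    using that L_mono[of x t] L_nonneg l_nonneg l_le_1
    unfolding abs_mult by (intro mult_mono) (auto simp: power_le_one)
qed measurable

definition Icc_energy :: "real \<Rightarrow> real \<Rightarrow> real" where
  "Icc_energy s t = 2 * integral {s..t} (\<lambda>x. L x * (l x)\<^sup>2)"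

lemma has_integral_Icc_energy: "((\<lambda>x. 2 * (L x * (l x)\<^sup>2)) has_integral Icc_energy s t) {s..t}"
  unfolding Icc_energy_def by (intro has_integral_mult_right integrable_integral integrable_L_sq)

lemma Icc_energy_combine: "s \<le> m \<Longrightarrow> m \<le> t \<Longrightarrow> Icc_energy s m + Icc_energy m t = Icc_energy s t"
  using Henstock_Kurzweil_Integration.integral_combine[OF _ _ integrable_L_sq, of s m t]
  by (simp add: Icc_energy_def)

lemma has_integral_energy_row:
  assumes "0 \<le> y" "y \<le> 1"
  shows "((\<lambda>x. l x * l y * min (l x) (l y)) has_integral L y * (l y)\<^sup>2 + l y * (Lsq 1 - Lsq y)) {0..1}"
proof (rule has_integral_combine[OF assms])
  have "((\<lambda>x. l x * (l y)\<^sup>2) has_integral (L y - L 0) * (l y)\<^sup>2) {0..y}"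
    using assms by (intro has_integral_mult_left has_integral_l) auto
  then have "((\<lambda>x. l x * (l y)\<^sup>2) has_integral L y * (l y)\<^sup>2) {0..y}"
    by simp
  then show "((\<lambda>x. l x * l y * min (l x) (l y)) has_integral L y * (l y)\<^sup>2) {0..y}"
    by (rule has_integral_eq[rotated]) (auto simp: l_antimono power2_eq_square min_absorb2)
  have "((\<lambda>x. l y * (l x)\<^sup>2) has_integral l y * (Lsq 1 - Lsq y)) {y..1}"
    using assms by (intro has_integral_mult_right has_integral_l_sq)
  then show "((\<lambda>x. l x * l y * min (l x) (l y)) has_integral l y * (Lsq 1 - Lsq y)) {y..1}"
    by (rule has_integral_eq[rotated]) (auto simp: l_antimono power2_eq_square min_absorb1)
qed

lemma has_integral_l_times_tail_sq:
  "((\<lambda>x. l x * (Lsq 1 - Lsq x)) has_integral Icc_energy 0 1 / 2) {0..1}"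
proof -
  have "((\<lambda>x. l x * (Lsq 1 - Lsq x) - L x * (l x)\<^sup>2) has_integral
      L 1 * (Lsq 1 - Lsq 1) - L 0 * (Lsq 1 - Lsq 0)) {0..1}"
  proof (rule has_integral_DERIV)
    show "continuous_on {0..1} (\<lambda>x. L x * (Lsq 1 - Lsq x))"
      by (intro continuous_intros continuous_on_L continuous_on_Lsq) auto
    show "((\<lambda>x. L x * (Lsq 1 - Lsq x)) has_real_derivative l x * (Lsq 1 - Lsq x) - L x * (l x)\<^sup>2) (at x)"
      if "x \<in> {0<..<1} - Z" for x
      using DERIV_L[OF that] DERIV_Lsq[OF that] by (auto intro!: derivative_eq_intros)
  qed auto
  from has_integral_add[OF this integrable_integral[OF integrable_L_sq]] show ?thesis
    by (simp add: Icc_energy_def)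
qed

lemma Icc_energy_eq:
  "integral {0..1} (\<lambda>y. integral {0..1} (\<lambda>x. l x * l y * min (l x) (l y)))
    = Icc_energy 0 1"
proof -
  have "integral {0..1} (\<lambda>y. integral {0..1} (\<lambda>x. l x * l y * min (l x) (l y)))
      = integral {0..1} (\<lambda>y. L y * (l y)\<^sup>2 + l y * (Lsq 1 - Lsq y))"
    using has_integral_energy_row by (intro integral_cong integral_unique) auto
  also have "\<dots> = Icc_energy 0 1"
    using has_integral_add[OF integrable_integral[OF integrable_L_sq] has_integral_l_times_tail_sq]
    by (simp add: integral_unique Icc_energy_def)
  finally show ?thesis .
qed

lemma has_integral_l_centred:
  assumes "0 \<le> s" "s \<le> t" "t \<le> 1"
  shows "((\<lambda>x. l x * ((L s + L t) / 2 - L x)) has_integral 0) {s..t}"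
proof -
  define F where "F x = (L s + L t) * L x - (L x)\<^sup>2" for x
  have "((\<lambda>x. l x * ((L s + L t) / 2 - L x)) has_integral F t / 2 - F s / 2) {s..t}"
  proof (rule has_integral_DERIV[OF assms])
    show "continuous_on {s..t} (\<lambda>x. F x / 2)"
      unfolding F_def using assms by (intro continuous_intros continuous_on_L) auto
    show "((\<lambda>x. F x / 2) has_real_derivative l x * ((L s + L t) / 2 - L x)) (at x)"
      if "x \<in> {0<..<1} - Z" for x
      unfolding F_def using DERIV_L[OF that] by (auto intro!: derivative_eq_intros simp: field_simps)
  qed
  then show ?thesis
    by (simp add: F_def power2_eq_square algebra_simps)
qed

lemma Icc_energy_le:
  assumes "0 \<le> s" "s \<le> t" "t \<le> 1"
  shows "Icc_energy s t \<le> (L s + L t) * (Lsq t - Lsq s)"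
proof -
  define m where "m = (L s + L t) / 2"
  have "\<exists>z\<ge>s. z \<le> t \<and> L z = m"
    using assms L_mono[of s t] by (intro IVT' continuous_on_L) (auto simp: m_def)
  then obtain z where z: "L z = m"
    by blast
  \<comment> \<open>Both \<open>l\<close> and \<open>m - L\<close> decrease and \<open>m - L\<close> vanishes at \<open>z\<close>, so by Chebyshev's argument one factor
    \<open>l\<close> may be replaced by \<open>l z\<close>.\<close>
  have pointwise: "2 * (L x * (l x)\<^sup>2) \<le> (L s + L t) * (l x)\<^sup>2 - 2 * l z * (l x * (m - L x))" for x
  proof -
    have "0 \<le> (l x - l z) * (m - L x)"
      using l_antimono[of x z] l_antimono[of z x] L_mono[of x z] L_mono[of z x] z
      by (cases "x \<le> z") (auto simp: mult_nonpos_nonpos)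
    then have "0 \<le> l x * ((l x - l z) * (m - L x))"
      using l_nonneg[of x] by (simp add: zero_le_mult_iff)
    then show ?thesis
      by (simp add: m_def power2_eq_square field_simps)
  qed
  have "((\<lambda>x. (L s + L t) * (l x)\<^sup>2 - 2 * l z * (l x * (m - L x))) has_integral
      (L s + L t) * (Lsq t - Lsq s) - 2 * l z * 0) {s..t}"
    unfolding m_def using assms
    by (intro has_integral_diff has_integral_mult_right has_integral_l_sq has_integral_l_centred)
  with has_integral_Icc_energy have "Icc_energy s t \<le> (L s + L t) * (Lsq t - Lsq s) - 2 * l z * 0"
    using pointwise by (rule has_integral_le)
  then show ?thesis
    by simp
qed

lemma diagonal_crossing:
  obtains a where "0 \<le> a" "a \<le> 1" "\<And>x. x < a \<Longrightarrow> a \<le> l x" "\<And>x. a < x \<Longrightarrow> l x \<le> a"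
proof -
  define X where "X = {x. x \<le> l x}"
  have "0 \<in> X"
    using l_nonneg by (simp add: X_def)
  then have "X \<noteq> {}"
    by blast
  have X_le_1: "x \<le> 1" if "x \<in> X" for x
    using that l_le_1[of x] by (simp add: X_def)
  then have bdd: "bdd_above X"
    by (rule bdd_aboveI)
  show ?thesis
  proof (rule that[of "Sup X"])
    show "0 \<le> Sup X"
      using \<open>0 \<in> X\<close> bdd by (rule cSup_upper)
    show "Sup X \<le> 1"
      using \<open>X \<noteq> {}\<close> X_le_1 by (rule cSup_least)
    show "Sup X \<le> l x" if x: "x < Sup X" for x
    proof (rule cSup_least)
      obtain z where z: "z \<in> X" "x < z"
        using less_cSupD[of X x] x \<open>X \<noteq> {}\<close> by blast
      fix y assume "y \<in> X"
      then have "max y z \<le> l (max y z)"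
        using z by (auto simp: X_def max_def)
      also have "\<dots> \<le> l x"
        using z by (intro l_antimono) auto
      finally show "y \<le> l x"
        by simp
    qed (fact \<open>X \<noteq> {}\<close>)
    show "l x \<le> Sup X" if "Sup X < x" for x
    proof (rule dense_ge_bounded[OF that])
      fix y assume y: "Sup X < y" "y < x"
      then have "y \<notin> X"
        using bdd cSup_upper[of y X] by auto
      then show "l x \<le> y"
        using l_antimono[of y x] y by (auto simp: X_def)
    qed
  qed
qed

lemma Lsq_diff_le:
  assumes "0 \<le> s" "s \<le> t" "\<And>x. s < x \<Longrightarrow> x < t \<Longrightarrow> l x \<le> k"
  shows "Lsq t - Lsq s \<le> k * (L t - L s)"
proof (rule has_integral_le_interior)
  show "((\<lambda>x. k * l x) has_integral k * (L t - L s)) {s..t}"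
    using assms by (intro has_integral_mult_right has_integral_l)
  show "((\<lambda>x. (l x)\<^sup>2) has_integral Lsq t - Lsq s) {s..t}"
    using assms by (intro has_integral_l_sq)
  show "(l x)\<^sup>2 \<le> k * l x" if "s < x" "x < t" for x
    using assms(3)[OF that] l_nonneg[of x] by (simp add: power2_eq_square mult_right_mono)
qed

lemma Icc_energy_le_square: "Icc_energy 0 1 \<le> (L 1)\<^sup>2"
proof -
  have "Icc_energy 0 1 \<le> L 1 * Lsq 1"
    using Icc_energy_le[of 0 1] by simp
  also have "\<dots> \<le> L 1 * L 1"
    using Lsq_diff_le[of 0 1 1] l_le_1 L_nonneg by (intro mult_left_mono) auto
  finally show ?thesis
    by (simp add: power2_eq_square)
qed

end

locale diagonal_cut = sorted_degree +
  fixes a :: real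
  assumes a_pos: "0 < a" and a_less_1: "a < 1"
    and l_ge: "x < a \<Longrightarrow> a \<le> l x"
    and l_le: "a < x \<Longrightarrow> l x \<le> a"
begin

definition V :: "real \<Rightarrow> real" where
  "V x = L x - a * x"

lemma V_0 [simp]: "V 0 = 0"
  by (simp add: V_def)

lemma L_a: "L a = a\<^sup>2 + V a"
  by (simp add: V_def power2_eq_square)

lemma continuous_on_V: "continuous_on {0..a} V"
  unfolding V_def by (intro continuous_intros continuous_on_L) auto

lemma has_integral_V: "(V has_integral integral {0..a} V) {0..a}"
  using continuous_on_V by (intro integrable_integral integrable_continuous_real)

lemma DERIV_V: "x \<in> {0<..<1} - Z \<Longrightarrow> (V has_real_derivative l x - a) (at x)"
  unfolding V_def using DERIV_L by (auto intro!: derivative_eq_intros)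

lemma mult_excess_le_V: "0 \<le> x \<Longrightarrow> x * (l x - a) \<le> V x"
  using mult_l_le_L[of x] by (simp add: V_def algebra_simps)

lemma V_nonneg: "0 \<le> x \<Longrightarrow> x \<le> a \<Longrightarrow> 0 \<le> V x"
  using const_le_L_diff[of 0 x a] l_ge by (simp add: V_def mult.commute)

lemma V_le_V_a: "0 \<le> x \<Longrightarrow> x \<le> a \<Longrightarrow> V x \<le> V a"
  using const_le_L_diff[of x a a] l_ge by (simp add: V_def algebra_simps)

lemma chord_le_V:
  assumes "0 \<le> x" "x \<le> a"
  shows "V a / a * x \<le> V x"
proof -
  have "x * (L a - L x) \<le> x * ((a - x) * l x)"
    using assms by (intro mult_left_mono L_diff_le)
  also have "\<dots> = (a - x) * (x * l x)"
    by simp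
  also have "\<dots> \<le> (a - x) * L x"
    using assms by (intro mult_left_mono mult_l_le_L) auto
  finally show ?thesis
    using a_pos by (simp add: V_def field_simps)
qed

lemma has_integral_mult_excess:
  "((\<lambda>x. x * (l x - a)) has_integral a * V a - integral {0..a} V) {0..a}"
proof -
  have "((\<lambda>x. V x + x * (l x - a)) has_integral a * V a - 0 * V 0) {0..a}"
  proof (rule has_integral_DERIV)
    show "continuous_on {0..a} (\<lambda>x. x * V x)"
      by (intro continuous_intros continuous_on_V)
    show "((\<lambda>x. x * V x) has_real_derivative V x + x * (l x - a)) (at x)" if "x \<in> {0<..<1} - Z" for x
      using DERIV_V[OF that] by (auto intro!: derivative_eq_intros)
  qed (use a_pos a_less_1 in auto)
  from has_integral_diff[OF this has_integral_V] show ?thesis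
    by simp
qed

lemma has_integral_excess: "((\<lambda>x. l x - a) has_integral V a) {0..a}"
  using has_integral_DERIV[OF _ _ _ continuous_on_V DERIV_V] a_pos a_less_1 by simp

lemma has_integral_V_mult_excess: "((\<lambda>x. V x * (l x - a)) has_integral (V a)\<^sup>2 / 2) {0..a}"
proof -
  have "((\<lambda>x. V x * (l x - a)) has_integral (V a)\<^sup>2 / 2 - (V 0)\<^sup>2 / 2) {0..a}"
  proof (rule has_integral_DERIV)
    show "continuous_on {0..a} (\<lambda>x. (V x)\<^sup>2 / 2)"
      by (intro continuous_intros continuous_on_V) auto
    show "((\<lambda>x. (V x)\<^sup>2 / 2) has_real_derivative V x * (l x - a)) (at x)" if "x \<in> {0<..<1} - Z" for x
      using DERIV_V[OF that] by (auto intro!: derivative_eq_intros)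
  qed (use a_pos a_less_1 in auto)
  then show ?thesis
    by simp
qed

lemma integral_V_ge: "a * V a / 2 \<le> integral {0..a} V"
proof -
  have "a * V a - integral {0..a} V \<le> integral {0..a} V"
    using has_integral_mult_excess has_integral_V by (rule has_integral_le) (simp add: mult_excess_le_V)
  then show ?thesis
    by simp
qed

lemma integral_V_le: "integral {0..a} V \<le> a * V a - (V a)\<^sup>2 / (2 * (1 - a))"
proof -
  have "((\<lambda>x. V a * (l x - a) - V x * (l x - a)) has_integral V a * V a - (V a)\<^sup>2 / 2) {0..a}"
    by (intro has_integral_diff has_integral_mult_right has_integral_excess has_integral_V_mult_excess)
  moreover have "((\<lambda>x. (1 - a) * (V a - V x)) has_integral
      (1 - a) * (a * V a - integral {0..a} V)) {0..a}"
    using has_integral_const_real[of "V a" 0 a] a_pos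
    by (intro has_integral_mult_right has_integral_diff has_integral_V) auto
  moreover have "V a * (l x - a) - V x * (l x - a) \<le> (1 - a) * (V a - V x)" if "x \<in> {0..a}" for x
    using mult_right_mono[of "l x - a" "1 - a" "V a - V x"] V_le_V_a[of x] l_le_1[of x] that
    by (simp add: algebra_simps)
  ultimately have "V a * V a - (V a)\<^sup>2 / 2 \<le> (1 - a) * (a * V a - integral {0..a} V)"
    by (rule has_integral_le)
  then show ?thesis
    using a_less_1 by (simp add: field_simps power2_eq_square)
qed

lemma energy_integrand_le:
  assumes x: "0 < x" "x < a"
  defines "m \<equiv> V a / a" and "D \<equiv> 1 - a"
  shows "2 * (L x * (l x)\<^sup>2) \<le> 2 * a ^ 3 * x + 2 * a\<^sup>2 * V x + (4 * a\<^sup>2 - 2 * m * D) * (x * (l x - a))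
    + (6 * a + 2 * (D + m)) * (V x * (l x - a))"
proof -
  define v where "v = l x - a"
  have v: "0 \<le> v" "v \<le> D"
    using x l_ge[of x] l_le_1[of x] by (auto simp: v_def D_def)
  have xv: "x * v \<le> V x" and mx: "m * x \<le> V x"
    using x mult_excess_le_V[of x] chord_le_V[of x] by (auto simp: v_def m_def)
  have "0 \<le> m"
    using V_nonneg[of a] a_pos by (simp add: m_def)
  have "0 \<le> m * (V x - x * v) + (V x - m * x) * (D - v)"
    using \<open>0 \<le> m\<close> xv mx v by simp
  then have "(2 * v) * (V x * v) \<le> (2 * v) * ((D + m) * V x - m * D * x)"
    using v by (intro mult_left_mono) (auto simp: algebra_simps)
  moreover have "(2 * a * v) * (x * v) \<le> (2 * a * v) * V x"
    using v a_pos xv by (intro mult_left_mono) auto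
  moreover have "2 * (L x * (l x)\<^sup>2) = 2 * ((a * x + V x) * (a + v)\<^sup>2)"
    by (simp add: V_def v_def)
  ultimately show ?thesis
    unfolding v_def[symmetric] by (simp add: power2_eq_square power3_eq_cube algebra_simps)
qed

lemma Icc_energy_head_le:
  "Icc_energy 0 a
    \<le> a ^ 5 + 4 * a ^ 3 * V a + 3 * a * (V a)\<^sup>2 - (1 - a) * (V a)\<^sup>2 + V a ^ 3 / a
      + 2 * ((1 - a) * V a / a - a\<^sup>2) * integral {0..a} V"
proof -
  let ?m = "V a / a" and ?D = "1 - a" and ?q = "integral {0..a} V"
  have "((\<lambda>x. x) has_integral a\<^sup>2 / 2) {0..a}"
    using ident_has_integral[of 0 a] a_pos by simp
  then have "((\<lambda>x. 2 * a ^ 3 * x + 2 * a\<^sup>2 * V x + (4 * a\<^sup>2 - 2 * ?m * ?D) * (x * (l x - a))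
      + (6 * a + 2 * (?D + ?m)) * (V x * (l x - a))) has_integral
      2 * a ^ 3 * (a\<^sup>2 / 2) + 2 * a\<^sup>2 * ?q + (4 * a\<^sup>2 - 2 * ?m * ?D) * (a * V a - ?q)
      + (6 * a + 2 * (?D + ?m)) * ((V a)\<^sup>2 / 2)) {0..a}"
    by (intro has_integral_add has_integral_mult_right has_integral_V has_integral_mult_excess
        has_integral_V_mult_excess)
  then have "Icc_energy 0 a
      \<le> 2 * a ^ 3 * (a\<^sup>2 / 2) + 2 * a\<^sup>2 * ?q + (4 * a\<^sup>2 - 2 * ?m * ?D) * (a * V a - ?q)
      + (6 * a + 2 * (?D + ?m)) * ((V a)\<^sup>2 / 2)"
    using energy_integrand_le by (intro has_integral_le_interior[OF has_integral_Icc_energy])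
  also have "\<dots> = a ^ 5 + 4 * a ^ 3 * V a + 3 * a * (V a)\<^sup>2 - ?D * (V a)\<^sup>2 + V a ^ 3 / a
      + 2 * (?D * V a / a - a\<^sup>2) * ?q"
    using a_pos by (simp add: field_simps eval_nat_numeral)
  finally show ?thesis .
qed

lemma L_tail_le: "L 1 - L a \<le> a * (1 - a)"
  using L_diff_le_const[of a 1 a] l_le a_pos a_less_1 by (simp add: mult.commute)

end

locale graphic_degree = sorted_degree +
  assumes erdos_gallai: "0 \<le> x \<Longrightarrow> x \<le> 1 \<Longrightarrow>
    integral {0..x} l \<le> integral {0..1} (\<lambda>y. min x (l y))"

locale graphic_cut = graphic_degree + diagonal_cut
begin

lemma V_le_integral_min:
  assumes "0 \<le> x" "x \<le> a"
  shows "V x \<le> integral {a..1} (\<lambda>y. min x (l y))"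
proof -
  have int: "(\<lambda>y. min x (l y)) integrable_on {s..t}" for s t
    using assms l_nonneg a_less_1
    by (intro integrable_on_Icc_bounded[where B = 1]) (auto simp: min_le_iff_disj)
  have "L x \<le> integral {0..1} (\<lambda>y. min x (l y))"
    unfolding L_def using assms a_less_1 by (intro erdos_gallai) auto
  also have "\<dots> = integral {0..a} (\<lambda>y. min x (l y)) + integral {a..1} (\<lambda>y. min x (l y))"
    using a_pos a_less_1 by (intro Henstock_Kurzweil_Integration.integral_combine[symmetric] int) auto
  also have "integral {0..a} (\<lambda>y. min x (l y)) \<le> integral {0..a} (\<lambda>_. x)"
    using int by (intro integral_le) auto
  finally show ?thesis
    using a_pos by (simp add: V_def)
qed

lemma V_a_le_L_tail: "V a \<le> L 1 - L a"
proof -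
  have "V a \<le> integral {a..1} (\<lambda>y. min a (l y))"
    using a_pos by (intro V_le_integral_min) auto
  also have "\<dots> \<le> integral {a..1} l"
    using a_pos l_nonneg
    by (intro integral_le integrable_l integrable_on_Icc_bounded[where B = a])
      (auto simp: min_le_iff_disj)
  also have "\<dots> = L 1 - L a"
    using has_integral_l[of a 1] a_pos a_less_1 by (simp add: integral_unique)
  finally show ?thesis .
qed

lemma integral_V_add_Lsq_tail_le: "integral {0..a} V + (Lsq 1 - Lsq a) / 2 \<le> a * (L 1 - L a)"
proof -
  have "((\<lambda>x. integral {a..1} (\<lambda>y. min x (l y))) has_integral
      integral {a..1} (\<lambda>y. integral {0..a} (\<lambda>x. min x (l y)))) {0..a}"
  proof (rule has_integral_integral_swap)
    have "(\<lambda>z. min (fst z) (l (snd z))) \<in> borel_measurable (borel \<Otimes>\<^sub>M borel)"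
      by measurable
    then show "(\<lambda>(x, y). min x (l y)) \<in> borel_measurable borel"
      by (simp add: borel_prod case_prod_beta')
    show "\<bar>min x (l y)\<bar> \<le> a" if "x \<in> {0..a}" for x y
      using that l_nonneg[of y] by auto
  qed
  then have "integral {0..a} V \<le> integral {a..1} (\<lambda>y. integral {0..a} (\<lambda>x. min x (l y)))"
    by (rule has_integral_le[OF has_integral_V]) (simp add: V_le_integral_min)
  also have "\<dots> = integral {a..1} (\<lambda>y. a * l y - (l y)\<^sup>2 / 2)"
    using l_nonneg l_le
    by (intro integral_spike[of "{a}"] integral_unique[OF has_integral_min, symmetric]) auto
  also have "\<dots> = a * (L 1 - L a) - (Lsq 1 - Lsq a) / 2"
    using a_pos a_less_1
    by (intro integral_unique has_integral_diff has_integral_mult_right has_integral_divide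
        has_integral_l has_integral_l_sq) auto
  finally show ?thesis
    by simp
qed

lemma Icc_energy_le_extremal_value: "Icc_energy 0 1 \<le> extremal_value (L 1)"
proof -
  have "Icc_energy 0 1 = Icc_energy 0 a + Icc_energy a 1"
    using Icc_energy_combine[of 0 a 1] a_pos a_less_1 by simp
  also have "\<dots> \<le> a ^ 5 + 4 * a ^ 3 * V a + 3 * a * (V a)\<^sup>2 - (1 - a) * (V a)\<^sup>2 + V a ^ 3 / a
      + 2 * ((1 - a) * V a / a - a\<^sup>2) * integral {0..a} V + (L a + L 1) * (Lsq 1 - Lsq a)"
    using a_pos a_less_1 by (intro add_mono Icc_energy_head_le Icc_energy_le) auto
  also have "L a + L 1 = 2 * a\<^sup>2 + 2 * V a + (L 1 - L a)"
    by (simp add: L_a)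
  also have "a ^ 5 + 4 * a ^ 3 * V a + 3 * a * (V a)\<^sup>2 - (1 - a) * (V a)\<^sup>2 + V a ^ 3 / a
      + 2 * ((1 - a) * V a / a - a\<^sup>2) * integral {0..a} V
      + (2 * a\<^sup>2 + 2 * V a + (L 1 - L a)) * (Lsq 1 - Lsq a)
    \<le> extremal_value (L 1)"
    using a_pos a_less_1 V_nonneg[of a] V_a_le_L_tail L_tail_le integral_V_ge integral_V_le
      Lsq_diff_le[of a 1 a] l_le integral_V_add_Lsq_tail_le
    by (intro cut_polynomial_le) (auto simp: L_a)
  finally show ?thesis .
qed

end

theorem (in graphic_degree) graphic_energy_le: "Icc_energy 0 1 \<le> extremal_value (L 1)"
proof -
  obtain a where a: "0 \<le> a" "a \<le> 1" and l_ge: "\<And>x. x < a \<Longrightarrow> a \<le> l x"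
    and l_le: "\<And>x. a < x \<Longrightarrow> l x \<le> a"
    by (rule diagonal_crossing) blast
  consider (boundary) "L 1 \<in> {0, 1}" | (interior) "0 < a" "a < 1"
  proof -
    have "L 1 = 0" if "a = 0"
      using L_diff_le_const[of 0 1 0] l_le L_nonneg[of 1] that by simp
    moreover have "L 1 = 1" if "a = 1"
      using const_le_L_diff[of 0 1 1] l_ge L_le[of 1] that by simp
    ultimately show thesis
      using that a by fastforce
  qed
  then show ?thesis
  proof cases
    case boundary
    then show ?thesis
      using Icc_energy_le_square by (auto simp: extremal_value_def clique_value_def le_max_iff_disj)
  next
    case interior
    then interpret graphic_cut l Z a
      using l_ge l_le by unfold_locales
    show ?thesis
      by (rule Icc_energy_le_extremal_value)
  qed
qed

section \<open>Step functions\<close>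

locale step_partition =
  fixes t :: "nat \<Rightarrow> real" and K :: nat
  assumes t_0: "t 0 = 0" and t_K: "t K = 1" and t_le_Suc: "i < K \<Longrightarrow> t i \<le> t (Suc i)"
begin

definition width :: "nat \<Rightarrow> real" where
  "width i = t (Suc i) - t i"

text \<open>Outside \<open>[0,1)\<close> the index is clamped to the first or last cell, which keeps it monotone.\<close>

definition cell_index :: "real \<Rightarrow> nat" where
  "cell_index x = Max (insert 0 {i. i < K \<and> t i \<le> x})"

lemma K_pos: "0 < K"
  using t_0 t_K by (cases K) auto

lemma t_mono: "i \<le> j \<Longrightarrow> j \<le> K \<Longrightarrow> t i \<le> t j"
proof (induction j)
  case (Suc j)
  then show ?case
    using t_le_Suc[of j] by (cases "i = Suc j") auto
qed simp

lemma width_nonneg: "i < K \<Longrightarrow> 0 \<le> width i"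
  using t_le_Suc by (simp add: width_def)

lemma sum_width: "(\<Sum>i<K. width i) = 1"
  using sum_lessThan_telescope[of t K] by (simp add: width_def t_0 t_K)

lemma cell_index_less: "cell_index x < K"
  unfolding cell_index_def using K_pos by (subst Max_less_iff) auto

lemma cell_index_mono: "x \<le> y \<Longrightarrow> cell_index x \<le> cell_index y"
  unfolding cell_index_def by (intro Max_mono) auto

lemma cell_index_eqI:
  assumes "i < K" "t i \<le> x" "x < t (Suc i)"
  shows "cell_index x = i"
  unfolding cell_index_def
proof (rule Max_eqI)
  show "j \<le> i" if "j \<in> insert 0 {i. i < K \<and> t i \<le> x}" for j
    using that assms t_mono[of "Suc i" j] by (cases "j \<le> i") auto
qed (use assms in auto)

lemma cell_index_bounds:
  assumes "x \<in> {0..<1}"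
  shows "t (cell_index x) \<le> x" "x < t (Suc (cell_index x))"
proof -
  let ?I = "insert 0 {i. i < K \<and> t i \<le> x}"
  have "cell_index x \<in> ?I"
    unfolding cell_index_def by (intro Max_in) auto
  then show "t (cell_index x) \<le> x"
    using assms t_0 by auto
  show "x < t (Suc (cell_index x))"
  proof (cases "Suc (cell_index x) = K")
    case True
    then show ?thesis
      using assms t_K by simp
  next
    case False
    have "i \<le> cell_index x" if "i \<in> ?I" for i
      unfolding cell_index_def using that by (intro Max_ge) auto
    from this[of "Suc (cell_index x)"] show ?thesis
      using False cell_index_less[of x] by force
  qed
qed

lemma indicator_scale_step:
  fixes h :: "nat \<Rightarrow> real"
  shows "indicator {0..<1} x *\<^sub>R h (cell_index x) = (\<Sum>i<K. h i * indicator {t i..<t (Suc i)} x)"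
proof (cases "x \<in> {0..<1}")
  case True
  have "x \<in> {t i..<t (Suc i)} \<longleftrightarrow> i = cell_index x" if "i < K" for i
    using cell_index_eqI[OF that, of x] cell_index_bounds[OF True] by fastforce
  then have "(\<Sum>i<K. h i * indicator {t i..<t (Suc i)} x) = (\<Sum>i<K. if i = cell_index x then h i else 0)"
    by (intro sum.cong) (simp_all add: indicator_def)
  then show ?thesis
    using True cell_index_less[of x] by simp
next
  case False
  have "x \<notin> {t i..<t (Suc i)}" if "i < K" for i
    using False t_mono[of 0 i] t_mono[of "Suc i" K] that by (auto simp: t_0 t_K)
  then have "(\<Sum>i<K. h i * indicator {t i..<t (Suc i)} x) = 0"
    by (intro sum.neutral) simp
  then show ?thesis
    using False by simp
qed

lemma set_integrable_step:
  fixes h :: "nat \<Rightarrow> real"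
  shows "set_integrable lborel {0..<1} (\<lambda>x. h (cell_index x))"
  unfolding set_integrable_def indicator_scale_step
  using t_le_Suc
  by (intro Bochner_Integration.integrable_sum integrable_mult_right integrable_real_indicator) auto

lemma LBINT_step:
  fixes h :: "nat \<Rightarrow> real"
  shows "(LBINT x:{0..<1}. h (cell_index x)) = (\<Sum>i<K. width i * h i)"
proof -
  have "(LBINT x:{0..<1}. h (cell_index x)) = (\<Sum>i<K. LBINT x. h i * indicator {t i..<t (Suc i)} x)"
    unfolding set_lebesgue_integral_def indicator_scale_step using t_le_Suc
    by (intro Bochner_Integration.integral_sum integrable_mult_right integrable_real_indicator) auto
  also have "\<dots> = (\<Sum>i<K. width i * h i)"
    using t_le_Suc by (intro sum.cong) (auto simp: width_def mult.commute)
  finally show ?thesis .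
qed

lemma has_integral_step:
  fixes h :: "nat \<Rightarrow> real"
  shows "((\<lambda>x. h (cell_index x)) has_integral (\<Sum>i<K. width i * h i)) {0..1}"
proof -
  have "((\<lambda>x. h (cell_index x)) has_integral (LBINT x:{0..<1}. h (cell_index x))) {0..<1}"
    using set_borel_integral_eq_integral[OF set_integrable_step] by (simp add: has_integral_iff)
  then show ?thesis
    unfolding LBINT_step
    by (subst has_integral_spike_set_eq[of _ "{0..<1}"]) (auto intro: negligible_subset[of "{1}"])
qed

lemma integral_step:
  fixes h :: "nat \<Rightarrow> real"
  shows "integral {0..1} (\<lambda>x. h (cell_index x)) = (\<Sum>i<K. width i * h i)"
  using has_integral_step by (rule integral_unique)

lemma isCont_step:
  fixes h :: "nat \<Rightarrow> real"
  assumes "x \<in> {0<..<1} - t ` {..<K}"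
  shows "isCont (\<lambda>x. h (cell_index x)) x"
proof -
  define i where "i = cell_index x"
  have "i < K"
    by (simp add: i_def cell_index_less)
  have "t i \<le> x" "x < t (Suc i)"
    using assms cell_index_bounds[of x] by (auto simp: i_def)
  moreover have "t i \<noteq> x"
    using assms \<open>i < K\<close> by auto
  ultimately have x: "x \<in> {t i<..<t (Suc i)}"
    by simp
  have "continuous_on {t i<..<t (Suc i)} (\<lambda>x. h (cell_index x))
      \<longleftrightarrow> continuous_on {t i<..<t (Suc i)} (\<lambda>_. h i)"
    using cell_index_eqI[OF \<open>i < K\<close>] by (intro continuous_on_cong) auto
  then show ?thesis
    using x by (simp add: continuous_on_eq_continuous_at)
qed

end

section \<open>Weighted graphs\<close>

locale weighted_graph =
  fixes K :: nat and p :: "nat \<Rightarrow> real" and M :: "nat \<Rightarrow> nat \<Rightarrow> real"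
  assumes p_nonneg: "i < K \<Longrightarrow> 0 \<le> p i" and sum_p: "(\<Sum>i<K. p i) = 1"
    and M_nonneg: "i < K \<Longrightarrow> j < K \<Longrightarrow> 0 \<le> M i j" and M_le_1: "i < K \<Longrightarrow> j < K \<Longrightarrow> M i j \<le> 1"
    and M_sym: "i < K \<Longrightarrow> j < K \<Longrightarrow> M i j = M j i"

definition vertex_degree :: "nat \<Rightarrow> (nat \<Rightarrow> real) \<Rightarrow> (nat \<Rightarrow> nat \<Rightarrow> real) \<Rightarrow> nat \<Rightarrow> real" where
  "vertex_degree K p M i = (\<Sum>j<K. p j * M i j)"

definition edge_density :: "nat \<Rightarrow> (nat \<Rightarrow> real) \<Rightarrow> (nat \<Rightarrow> nat \<Rightarrow> real) \<Rightarrow> real" where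
  "edge_density K p M = (\<Sum>i<K. p i * vertex_degree K p M i)"

definition energy :: "nat \<Rightarrow> (nat \<Rightarrow> real) \<Rightarrow> (nat \<Rightarrow> real) \<Rightarrow> real" where
  "energy K p d = (\<Sum>j<K. p j * (\<Sum>i<K. p i * (d i * d j * min (d i) (d j))))"

context weighted_graph
begin

abbreviation d :: "nat \<Rightarrow> real" where
  "d \<equiv> vertex_degree K p M"

lemma vertex_degree_nonneg: "i < K \<Longrightarrow> 0 \<le> d i"
  unfolding vertex_degree_def by (intro sum_nonneg mult_nonneg_nonneg p_nonneg M_nonneg) auto

lemma vertex_degree_le_1:
  assumes "i < K"
  shows "d i \<le> 1"
proof -
  have "d i \<le> (\<Sum>j<K. p j * 1)"
    unfolding vertex_degree_def using assms by (intro sum_mono mult_left_mono p_nonneg M_le_1) auto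
  then show ?thesis
    by (simp add: sum_p)
qed

lemma vertex_degree_column: "j < K \<Longrightarrow> (\<Sum>i<K. p i * M i j) = d j"
  unfolding vertex_degree_def using M_sym by (intro sum.cong) auto

lemma weighted_graph_permute:
  assumes "bij_betw \<pi> {..<K} {..<K}"
  shows "weighted_graph K (\<lambda>i. p (\<pi> i)) (\<lambda>i j. M (\<pi> i) (\<pi> j))"
proof
  show "(\<Sum>i<K. p (\<pi> i)) = 1"
    using sum.reindex_bij_betw[OF assms, of p] sum_p by simp
qed (use bij_betwE[OF assms] p_nonneg M_nonneg M_le_1 M_sym in auto)

end

lemma vertex_degree_permute:
  assumes "bij_betw \<pi> {..<K} {..<K}"
  shows "vertex_degree K (\<lambda>i. p (\<pi> i)) (\<lambda>i j. M (\<pi> i) (\<pi> j)) = (\<lambda>i. vertex_degree K p M (\<pi> i))"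
  using sum.reindex_bij_betw[OF assms, of "\<lambda>j. p j * M (\<pi> i) j" for i]
  by (simp add: vertex_degree_def fun_eq_iff)

lemma edge_density_permute:
  assumes "bij_betw \<pi> {..<K} {..<K}"
  shows "edge_density K (\<lambda>i. p (\<pi> i)) (\<lambda>i j. M (\<pi> i) (\<pi> j)) = edge_density K p M"
  using sum.reindex_bij_betw[OF assms, of "\<lambda>i. p i * vertex_degree K p M i"]
  by (simp add: edge_density_def vertex_degree_permute[OF assms])

lemma energy_permute:
  assumes "bij_betw \<pi> {..<K} {..<K}"
  shows "energy K (\<lambda>i. p (\<pi> i)) (\<lambda>i. d (\<pi> i)) = energy K p d"
proof -
  have "(\<Sum>i<K. p (\<pi> i) * (d (\<pi> i) * z * min (d (\<pi> i)) z))
      = (\<Sum>i<K. p i * (d i * z * min (d i) z))" for z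
    using sum.reindex_bij_betw[OF assms, of "\<lambda>i. p i * (d i * z * min (d i) z)"] .
  then show ?thesis
    using sum.reindex_bij_betw[OF assms, of "\<lambda>j. p j * (\<Sum>i<K. p i * (d i * d j * min (d i) (d j)))"]
    by (simp add: energy_def)
qed

lemma sorting_permutation:
  fixes d :: "nat \<Rightarrow> real"
  obtains \<pi> where "bij_betw \<pi> {..<K} {..<K}" "\<And>i j. i \<le> j \<Longrightarrow> j < K \<Longrightarrow> d (\<pi> j) \<le> d (\<pi> i)"
proof -
  define xs where "xs = sort_key (\<lambda>i. - d i) [0..<K]"
  have xs: "length xs = K" "distinct xs" "set xs = {..<K}" "sorted (map (\<lambda>i. - d i) xs)"
    by (auto simp: xs_def)
  show thesis
  proof (rule that[of "(!) xs"])
    show "bij_betw ((!) xs) {..<K} {..<K}"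
      using bij_betw_nth[OF xs(2) refl refl] xs(1,3) by simp
    show "d (xs ! j) \<le> d (xs ! i)" if "i \<le> j" "j < K" for i j
      using sorted_nth_mono[OF xs(4), of i j] that xs(1) by simp
  qed
qed

locale step_graph = step_partition t K + weighted_graph K "step_partition.width t" M for t K M
begin

lemma integral_vertex_degree_le:
  assumes x: "0 \<le> x" "x \<le> 1"
  shows "integral {0..x} (\<lambda>u. d (cell_index u)) \<le> integral {0..1} (\<lambda>y. min x (d (cell_index y)))"
proof -
  have int: "(\<lambda>u. h (cell_index u)) integrable_on {0..x}" for h :: "nat \<Rightarrow> real"
    using x by (intro integrable_subinterval_real[OF has_integral_integrable[OF has_integral_step]]) auto
  have column_le: "integral {0..x} (\<lambda>u. M (cell_index u) j) \<le> min x (d j)" if "j < K" for j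
  proof (rule min.boundedI)
    have "integral {0..x} (\<lambda>u. M (cell_index u) j) \<le> integral {0..x} (\<lambda>_. 1)"
      using int[of "\<lambda>i. M i j"] that cell_index_less M_le_1 by (intro integral_le) auto
    then show "integral {0..x} (\<lambda>u. M (cell_index u) j) \<le> x"
      using x by simp
    have "integral {0..x} (\<lambda>u. M (cell_index u) j) \<le> integral {0..1} (\<lambda>u. M (cell_index u) j)"
      using int[of "\<lambda>i. M i j"] x that cell_index_less M_nonneg
        has_integral_integrable[OF has_integral_step[of "\<lambda>i. M i j"]]
      by (intro integral_subset_le) auto
    also have "\<dots> = d j"
      using that integral_step[of "\<lambda>i. M i j"] by (simp add: vertex_degree_column)
    finally show "integral {0..x} (\<lambda>u. M (cell_index u) j) \<le> d j" .
  qed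
  have "integral {0..x} (\<lambda>u. d (cell_index u))
      = (\<Sum>j<K. width j * integral {0..x} (\<lambda>u. M (cell_index u) j))"
    unfolding vertex_degree_def using int[of "\<lambda>i. M i j" for j]
    by (subst integral_sum) (auto intro: integrable_on_mult_right)
  also have "\<dots> \<le> (\<Sum>j<K. width j * min x (d j))"
    by (intro sum_mono mult_left_mono column_le p_nonneg) auto
  also have "\<dots> = integral {0..1} (\<lambda>y. min x (d (cell_index y)))"
    using integral_step[of "\<lambda>j. min x (d j)"] by simp
  finally show ?thesis .
qed

lemma graphic_degree_if_sorted:
  assumes "\<And>i j. i \<le> j \<Longrightarrow> j < K \<Longrightarrow> d j \<le> d i"
  shows "graphic_degree (\<lambda>x. d (cell_index x)) (t ` {..<K})"
proof
  show "antimono (\<lambda>x. d (cell_index x))"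
    by (intro antimonoI assms cell_index_mono cell_index_less)
qed (use isCont_step[of _ d] cell_index_less vertex_degree_nonneg vertex_degree_le_1
    integral_vertex_degree_le in auto)

lemma energy_le_if_sorted:
  assumes "\<And>i j. i \<le> j \<Longrightarrow> j < K \<Longrightarrow> d j \<le> d i"
  shows "energy K width d \<le> extremal_value (edge_density K width M)"
proof -
  interpret graphic_degree "\<lambda>x. d (cell_index x)" "t ` {..<K}"
    using assms by (rule graphic_degree_if_sorted)
  have "L 1 = edge_density K width M"
    unfolding L_def edge_density_def by (rule integral_step)
  moreover have "integral {0..1} (\<lambda>y. integral {0..1} (\<lambda>x. d (cell_index x) * d (cell_index y)
      * min (d (cell_index x)) (d (cell_index y)))) = energy K width d"
    unfolding energy_def using integral_step[of "\<lambda>i. d i * z * min (d i) z" for z]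
      integral_step[of "\<lambda>j. \<Sum>i<K. width i * (d i * d j * min (d i) (d j))"] by simp
  ultimately show ?thesis
    using graphic_energy_le Icc_energy_eq by simp
qed

end

theorem (in weighted_graph) energy_le:
  "energy K p d \<le> extremal_value (edge_density K p M)"
proof -
  obtain \<pi> where \<pi>: "bij_betw \<pi> {..<K} {..<K}"
    and sorted: "\<And>i j. i \<le> j \<Longrightarrow> j < K \<Longrightarrow> d (\<pi> j) \<le> d (\<pi> i)"
    using sorting_permutation[of K d] by blast
  note permuted = weighted_graph_permute[OF \<pi>]
  define t where "t k = (\<Sum>i<k. p (\<pi> i))" for k
  interpret step_partition t K
    using weighted_graph.p_nonneg[OF permuted] weighted_graph.sum_p[OF permuted]
    by unfold_locales (auto simp: t_def)
  have width: "width = (\<lambda>i. p (\<pi> i))"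
    by (simp add: width_def t_def fun_eq_iff)
  interpret permuted: step_graph t K "\<lambda>i j. M (\<pi> i) (\<pi> j)"
    using permuted by (intro step_graph.intro) (simp_all add: width step_partition_axioms)
  show ?thesis
    using permuted.energy_le_if_sorted sorted unfolding width
    by (simp add: vertex_degree_permute[OF \<pi>] edge_density_permute[OF \<pi>] energy_permute[OF \<pi>])
qed

section \<open>Step kernels\<close>

context step_partition
begin

lemma LBINT_step_cong:
  assumes "\<And>x. x \<in> {0..<1} \<Longrightarrow> f x = h (cell_index x)"
  shows "(LBINT x:{0..<1}. f x) = (\<Sum>i<K. width i * h i)"
  unfolding LBINT_step[symmetric] using assms by (intro set_lebesgue_integral_cong) auto

context
  fixes A :: "real \<Rightarrow> real \<Rightarrow> real" and M :: "nat \<Rightarrow> nat \<Rightarrow> real"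
  assumes A_eq: "x \<in> {0..<1} \<Longrightarrow> y \<in> {0..<1} \<Longrightarrow> A x y = M (cell_index x) (cell_index y)"
begin

lemma deg_step_kernel: "x \<in> {0..<1} \<Longrightarrow> deg A x = vertex_degree K width M (cell_index x)"
  unfolding deg_def vertex_degree_def using A_eq by (intro LBINT_step_cong)

lemma S_step_kernel: "S A = energy K width (vertex_degree K width M)"
  unfolding S_def energy_def by (intro LBINT_step_cong) (simp add: deg_step_kernel)

lemma LBINT_step_kernel:
  assumes "weighted_graph K width M"
  shows "(LBINT y:{0..<1}. LBINT x:{0..<1}. A x y) = edge_density K width M"
  unfolding edge_density_def
proof (rule LBINT_step_cong)
  interpret weighted_graph K width M by fact
  fix y :: real assume y: "y \<in> {0..<1}"
  then have "(LBINT x:{0..<1}. A x y) = (\<Sum>i<K. width i * M i (cell_index y))"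
    using A_eq by (intro LBINT_step_cong)
  then show "(LBINT x:{0..<1}. A x y) = vertex_degree K width M (cell_index y)"
    by (simp add: vertex_degree_column cell_index_less)
qed

end

lemma step_kernel_eq:
  assumes "\<forall>i\<in>{1..K}. \<forall>j\<in>{1..K}.
      (\<lambda>(x, y). A x y) constant_on ({t (i - 1)..<t i} \<times> {t (j - 1)..<t j})"
    and x: "x \<in> {0..<1}" and y: "y \<in> {0..<1}"
  shows "A x y = A (t (cell_index x)) (t (cell_index y))"
proof -
  let ?i = "cell_index x" and ?j = "cell_index y"
  have "(\<lambda>(x, y). A x y) constant_on ({t ?i..<t (Suc ?i)} \<times> {t ?j..<t (Suc ?j)})"
    using assms(1)[rule_format, of "Suc ?i" "Suc ?j"] cell_index_less by (simp add: Suc_leI)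
  then obtain k where k: "\<And>z. z \<in> {t ?i..<t (Suc ?i)} \<times> {t ?j..<t (Suc ?j)} \<Longrightarrow> (\<lambda>(x, y). A x y) z = k"
    unfolding constant_on_def by blast
  show ?thesis
    using k[of "(x, y)"] k[of "(t ?i, t ?j)"] cell_index_bounds[OF x] cell_index_bounds[OF y] by auto
qed

end

lemma S_two_step_kernel:
  fixes s \<alpha> \<beta> \<gamma> :: real
  assumes s: "0 \<le> s" "s \<le> 1"
    and A: "\<And>x y. x \<in> {0..<1} \<Longrightarrow> y \<in> {0..<1} \<Longrightarrow>
      A x y = (if x < s then if y < s then \<alpha> else \<beta> else if y < s then \<beta> else \<gamma>)"
  defines "d0 \<equiv> s * \<alpha> + (1 - s) * \<beta>" and "d1 \<equiv> s * \<beta> + (1 - s) * \<gamma>"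
  shows "S A = s\<^sup>2 * d0 ^ 3 + 2 * s * (1 - s) * (d0 * d1 * min d0 d1) + (1 - s)\<^sup>2 * d1 ^ 3"
proof -
  define t :: "nat \<Rightarrow> real" where "t i = (if i = 0 then 0 else if i = 1 then s else 1)" for i
  define M :: "nat \<Rightarrow> nat \<Rightarrow> real" where
    "M i j = (if i = 0 then if j = 0 then \<alpha> else \<beta> else if j = 0 then \<beta> else \<gamma>)" for i j
  interpret step_partition t 2
    using s by unfold_locales (auto simp: t_def)
  have index: "cell_index x = (if x < s then 0 else 1)" if "x \<in> {0..<1}" for x
    using that by (intro cell_index_eqI) (auto simp: t_def)
  have "S A = energy 2 width (vertex_degree 2 width M)"
    by (rule S_step_kernel) (simp add: A M_def index)
  moreover have "vertex_degree 2 width M 0 = d0" "vertex_degree 2 width M 1 = d1"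
    by (simp_all add: vertex_degree_def eval_nat_numeral width_def t_def M_def d0_def d1_def)
  ultimately show ?thesis
    by (simp add: energy_def eval_nat_numeral width_def t_def min.commute algebra_simps)
qed

lemma S_A1:
  assumes "0 \<le> c" "c \<le> 1"
  shows "S (A1 c) = star_value c"
proof -
  obtain s where s: "0 \<le> s" "s \<le> 1" and c: "c = s * (2 - s)"
    using assms by (rule star_density_cases)
  have "S (A1 c) = s\<^sup>2 + 2 * s * (1 - s) * s\<^sup>2 + (1 - s)\<^sup>2 * s ^ 3"
    using S_two_step_kernel[OF s, of "A1 c" 1 1 0] s(2)
    by (simp add: A1_def c sqrt_one_minus_star_density min_less_iff_disj min_absorb2 power2_eq_square)
  also have "\<dots> = star_value c"
    unfolding c star_value_star_density[OF s(2)] by (simp add: eval_nat_numeral algebra_simps)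
  finally show ?thesis .
qed

lemma S_A2:
  assumes "0 \<le> c" "c \<le> 1"
  shows "S (A2 c) = clique_value c"
proof -
  have "0 \<le> sqrt c" "sqrt c \<le> 1"
    using assms by auto
  from S_two_step_kernel[OF this, of "A2 c" 1 0 0] show ?thesis
    by (simp add: A2_def clique_value_def eval_nat_numeral)
qed

theorem theorem7:
  fixes c :: real and K :: nat and A :: "real \<Rightarrow> real \<Rightarrow> real" and q :: "nat \<Rightarrow> real"
  assumes "0 \<le> c" and "c \<le> 1" and "K > 0"
    and "\<forall>x\<in>{0..<1}. \<forall>y\<in>{0..<1}. A x y \<in> {0..1}"
    and "(LBINT y:{0..<1}. LBINT x:{0..<1}. A x y) = c"
    and "\<forall>x\<in>{0..<1}. \<forall>y\<in>{0..<1}. A x y = A y x"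
    and "q 0 = 0" and "q K = 1" and "\<forall>i\<in>{1..K}. q (i - 1) < q i"
    and "\<forall>i\<in>{1..K}. \<forall>j\<in>{1..K}.
           (\<lambda>(x, y). A x y) constant_on ({q (i - 1)..<q i} \<times> {q (j - 1)..<q j})"
  shows "S A \<le> max (S (A1 c)) (S (A2 c)) \<and>
         max (S (A1 c)) (S (A2 c)) =
           max ((1 - sqrt (1 - c))\<^sup>2 * ((c + 1) * sqrt (1 - c) + c)) (c powr (5 / 2))"
proof -
  have q_less: "q i < q (Suc i)" if "i < K" for i
    using assms(9)[rule_format, of "Suc i"] that by simp
  interpret step_partition q K
    using assms(7,8) q_less by unfold_locales (auto intro: less_imp_le)
  define M where "M i j = A (q i) (q j)" for i j
  have A_eq: "A x y = M (cell_index x) (cell_index y)" if "x \<in> {0..<1}" "y \<in> {0..<1}" for x y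
    using step_kernel_eq[OF assms(10) that] by (simp add: M_def)
  have q_in: "q i \<in> {0..<1}" if "i < K" for i
    using that t_mono[of 0 i] t_mono[of "Suc i" K] q_less[of i] assms(7,8) by auto
  interpret weighted_graph K width M
    using assms(4,6) q_in width_nonneg sum_width by unfold_locales (auto simp: M_def)
  have "edge_density K width M = c"
    using LBINT_step_kernel[of A M, OF A_eq weighted_graph_axioms] assms(5) by simp
  then have "S A \<le> extremal_value c"
    using S_step_kernel[of A M, OF A_eq] energy_le by simp
  then show ?thesis
    using assms(1,2) by (simp add: S_A1 S_A2 extremal_value_def star_value_def flip: clique_value_eq_powr)
qed

end
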